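(* Let $p$ be a prime and let $G$ be a finite $p$-group of derived length $d\geq 1$. Then $\exp \mathrm{M}(G)$ divides $2^{d-1}\cdot(\exp G)^d$ if $p=2$, and $\exp \mathrm{M}(G)$ divides $(\exp G)^d$ if $p>2$.
   Context: $\mathrm{M}(G)=H^2(G,\mathbb{C}^\times)$ (trivial action) denotes the Schur multiplier of the finite group $G$, and $\exp$ denotes the exponent of a group. *)

theory Defs
  imports
    Complex_Main
    "HOL-Computational_Algebra.Primes"
    "HOL-Algebra.Solvable_Groups"
    "HOL-Algebra.Product_Groups"
begin

section \<open>Exponent and derived length\<close>

text \<open>
  The value is \<open>0\<close> if and only if no positive \<open>n\<close> annihilates the group, so that
  a statement \<open>group_exponent G dvd m\<close> with \<open>m > 0\<close> includes the finiteness of the exponent.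
\<close>

definition group_exponent :: "('a, 'b) monoid_scheme \<Rightarrow> nat" where
  "group_exponent G =
     (if \<exists>n>0. \<forall>x\<in>carrier G. x [^]\<^bsub>G\<^esub> (n::nat) = \<one>\<^bsub>G\<^esub>
      then LEAST n. n > 0 \<and> (\<forall>x\<in>carrier G. x [^]\<^bsub>G\<^esub> n = \<one>\<^bsub>G\<^esub>)
      else 0)"

text \<open>Only meaningful for solvable groups; the trivial group has derived length \<open>0\<close>.\<close>

definition derived_length :: "('a, 'b) monoid_scheme \<Rightarrow> nat" where
  "derived_length G = (LEAST n. (derived G ^^ n) (carrier G) = {\<one>\<^bsub>G\<^esub>})"


section \<open>Second cohomology with trivial action\<close>

text \<open>
  Inhomogeneous cochains of \<open>G\<close> with values in a commutative group \<open>A\<close>, written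
  multiplicatively. The carriers consist of extensional functions, so that a cochain is
  determined by its values on \<open>carrier G\<close>.
\<close>

definition cochains1 ::
  "('a, 'b) monoid_scheme \<Rightarrow> ('c, 'd) monoid_scheme \<Rightarrow> ('a \<Rightarrow> 'c) monoid" where
  "cochains1 G A = product_group (carrier G) (\<lambda>_. A)"

definition cochains2 ::
  "('a, 'b) monoid_scheme \<Rightarrow> ('c, 'd) monoid_scheme \<Rightarrow> ('a \<times> 'a \<Rightarrow> 'c) monoid" where
  "cochains2 G A = product_group (carrier G \<times> carrier G) (\<lambda>_. A)"

definition cochains3 ::
  "('a, 'b) monoid_scheme \<Rightarrow> ('c, 'd) monoid_scheme \<Rightarrow> ('a \<times> 'a \<times> 'a \<Rightarrow> 'c) monoid" where
  "cochains3 G A = product_group (carrier G \<times> carrier G \<times> carrier G) (\<lambda>_. A)"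

definition coboundary1 ::
  "('a, 'b) monoid_scheme \<Rightarrow> ('c, 'd) monoid_scheme \<Rightarrow> ('a \<Rightarrow> 'c) \<Rightarrow> ('a \<times> 'a \<Rightarrow> 'c)" where
  "coboundary1 G A c =
     (\<lambda>(g, h)\<in>carrier G \<times> carrier G. c h \<otimes>\<^bsub>A\<^esub> inv\<^bsub>A\<^esub> (c (g \<otimes>\<^bsub>G\<^esub> h)) \<otimes>\<^bsub>A\<^esub> c g)"

definition coboundary2 ::
  "('a, 'b) monoid_scheme \<Rightarrow> ('c, 'd) monoid_scheme \<Rightarrow>
     ('a \<times> 'a \<Rightarrow> 'c) \<Rightarrow> ('a \<times> 'a \<times> 'a \<Rightarrow> 'c)" where
  "coboundary2 G A f =
     (\<lambda>(g, h, k)\<in>carrier G \<times> carrier G \<times> carrier G.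
        f (h, k) \<otimes>\<^bsub>A\<^esub> inv\<^bsub>A\<^esub> (f (g \<otimes>\<^bsub>G\<^esub> h, k)) \<otimes>\<^bsub>A\<^esub> f (g, h \<otimes>\<^bsub>G\<^esub> k)
          \<otimes>\<^bsub>A\<^esub> inv\<^bsub>A\<^esub> (f (g, h)))"

definition cocycles2 ::
  "('a, 'b) monoid_scheme \<Rightarrow> ('c, 'd) monoid_scheme \<Rightarrow> ('a \<times> 'a \<Rightarrow> 'c) set" where
  "cocycles2 G A = kernel (cochains2 G A) (cochains3 G A) (coboundary2 G A)"

definition coboundaries2 ::
  "('a, 'b) monoid_scheme \<Rightarrow> ('c, 'd) monoid_scheme \<Rightarrow> ('a \<times> 'a \<Rightarrow> 'c) set" where
  "coboundaries2 G A = coboundary1 G A ` carrier (cochains1 G A)"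

definition H2 ::
  "('a, 'b) monoid_scheme \<Rightarrow> ('c, 'd) monoid_scheme \<Rightarrow> ('a \<times> 'a \<Rightarrow> 'c) set monoid" where
  "H2 G A = ((cochains2 G A)\<lparr>carrier := cocycles2 G A\<rparr>) Mod coboundaries2 G A"

definition nonzero_complex :: "complex monoid" where
  "nonzero_complex = \<lparr>carrier = - {0}, monoid.mult = (*), one = 1\<rparr>"

definition schur_multiplier ::
  "('a, 'b) monoid_scheme \<Rightarrow> ('a \<times> 'a \<Rightarrow> complex) set monoid" where
  "schur_multiplier G = H2 G nonzero_complex"


section \<open>The quotient is a commutative group\<close>

lemma comm_group_nonzero_complex: "comm_group nonzero_complex"
proof (rule comm_groupI)
  show "\<exists>y\<in>carrier nonzero_complex. y \<otimes>\<^bsub>nonzero_complex\<^esub> x = \<one>\<^bsub>nonzero_complex\<^esub>"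
    if "x \<in> carrier nonzero_complex" for x
    using that by (intro bexI[of _ "inverse x"]) (auto simp: nonzero_complex_def)
qed (auto simp: nonzero_complex_def)

lemma comm_group_product_const:
  assumes "comm_group A"
  shows "comm_group (product_group I (\<lambda>_. A))"
proof -
  interpret A: comm_group A by fact
  interpret P: group "product_group I (\<lambda>_. A)" by (simp add: A.is_group)
  show ?thesis
    by (rule P.group_comm_groupI)
       (auto simp: PiE_iff A.m_comm intro!: restrict_ext)
qed

lemma coboundary1_hom:
  assumes "group G" and "comm_group A"
  shows "coboundary1 G A \<in> hom (cochains1 G A) (cochains2 G A)"
proof -
  interpret G: group G by fact
  interpret A: comm_group A by fact
  show ?thesis
    by (rule homI)
       (auto simp: coboundary1_def cochains1_def cochains2_def PiE_iff A.inv_mult A.m_ac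
         intro!: restrict_ext)
qed

lemma coboundary2_hom:
  assumes "group G" and "comm_group A"
  shows "coboundary2 G A \<in> hom (cochains2 G A) (cochains3 G A)"
proof -
  interpret G: group G by fact
  interpret A: comm_group A by fact
  show ?thesis
    by (rule homI)
       (auto simp: coboundary2_def cochains2_def cochains3_def PiE_iff A.inv_mult A.m_ac
         intro!: restrict_ext)
qed

lemma (in comm_group) four_term_cancel:
  assumes "a \<in> carrier G" "b \<in> carrier G" "c \<in> carrier G" "u \<in> carrier G" "v \<in> carrier G"
    "w \<in> carrier G"
  shows "(c \<otimes> inv u \<otimes> b) \<otimes> inv (c \<otimes> inv w \<otimes> v) \<otimes> (u \<otimes> inv w \<otimes> a) \<otimes> inv (b \<otimes> inv v \<otimes> a) = \<one>"
proof -
  have "inv (c \<otimes> inv w \<otimes> v) = inv c \<otimes> w \<otimes> inv v" "inv (b \<otimes> inv v \<otimes> a) = inv b \<otimes> v \<otimes> inv a"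
    using assms by (simp_all add: inv_mult)
  then have "(c \<otimes> inv u \<otimes> b) \<otimes> inv (c \<otimes> inv w \<otimes> v) \<otimes> (u \<otimes> inv w \<otimes> a) \<otimes> inv (b \<otimes> inv v \<otimes> a)
      = (c \<otimes> inv c) \<otimes> ((u \<otimes> inv u) \<otimes> ((b \<otimes> inv b) \<otimes> ((w \<otimes> inv w) \<otimes> ((v \<otimes> inv v) \<otimes> (a \<otimes> inv a)))))"
    using assms by (simp del: r_inv l_inv Units_r_inv Units_l_inv add: m_ac)
  then show ?thesis
    using assms by simp
qed

lemma coboundaries2_subset_cocycles2:
  assumes "group G" and "comm_group A"
  shows "coboundaries2 G A \<subseteq> cocycles2 G A"
proof
  interpret G: group G by fact
  interpret A: comm_group A by fact
  fix f assume "f \<in> coboundaries2 G A"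
  then obtain c where c: "c \<in> carrier (cochains1 G A)" and f: "f = coboundary1 G A c"
    by (auto simp: coboundaries2_def)
  have "f \<in> carrier (cochains2 G A)"
    using coboundary1_hom[OF assms] c f by (auto simp: hom_def)
  moreover have "coboundary2 G A f = \<one>\<^bsub>cochains3 G A\<^esub>"
    using c unfolding f
    by (auto simp: coboundary2_def coboundary1_def cochains1_def cochains3_def PiE_iff
        A.four_term_cancel G.m_assoc intro!: restrict_ext)
  ultimately show "f \<in> cocycles2 G A"
    by (simp add: cocycles2_def kernel_def)
qed

lemma comm_group_cocycles2:
  assumes "group G" and "comm_group A"
  shows "comm_group ((cochains2 G A)\<lparr>carrier := cocycles2 G A\<rparr>)"
proof -
  interpret C2: comm_group "cochains2 G A"
    unfolding cochains2_def by (rule comm_group_product_const) fact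
  interpret C3: comm_group "cochains3 G A"
    unfolding cochains3_def by (rule comm_group_product_const) fact
  interpret d2: group_hom "cochains2 G A" "cochains3 G A" "coboundary2 G A"
    by unfold_locales (rule coboundary2_hom[OF assms])
  have Z: "subgroup (cocycles2 G A) (cochains2 G A)"
    unfolding cocycles2_def by (rule d2.subgroup_kernel)
  interpret Z: group "(cochains2 G A)\<lparr>carrier := cocycles2 G A\<rparr>"
    by (rule C2.subgroup_imp_group[OF Z])
  show ?thesis
    by (rule Z.group_comm_groupI) (use subgroup.subset[OF Z] in \<open>auto intro: C2.m_comm\<close>)
qed

lemma normal_coboundaries2:
  assumes "group G" and "comm_group A"
  shows "coboundaries2 G A \<lhd> (cochains2 G A)\<lparr>carrier := cocycles2 G A\<rparr>"
proof -
  interpret C1: comm_group "cochains1 G A"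
    unfolding cochains1_def by (rule comm_group_product_const) fact
  interpret C2: comm_group "cochains2 G A"
    unfolding cochains2_def by (rule comm_group_product_const) fact
  interpret C3: comm_group "cochains3 G A"
    unfolding cochains3_def by (rule comm_group_product_const) fact
  interpret d1: group_hom "cochains1 G A" "cochains2 G A" "coboundary1 G A"
    by unfold_locales (rule coboundary1_hom[OF assms])
  interpret d2: group_hom "cochains2 G A" "cochains3 G A" "coboundary2 G A"
    by unfold_locales (rule coboundary2_hom[OF assms])
  interpret Z: comm_group "(cochains2 G A)\<lparr>carrier := cocycles2 G A\<rparr>"
    by (rule comm_group_cocycles2[OF assms])
  have "subgroup (coboundaries2 G A) (cochains2 G A)"
    unfolding coboundaries2_def by (rule d1.img_is_subgroup)
  moreover have "subgroup (cocycles2 G A) (cochains2 G A)"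
    unfolding cocycles2_def by (rule d2.subgroup_kernel)
  ultimately have "subgroup (coboundaries2 G A) ((cochains2 G A)\<lparr>carrier := cocycles2 G A\<rparr>)"
    using coboundaries2_subset_cocycles2[OF assms] by (rule C2.subgroup_incl)
  then show ?thesis
    by (rule Z.subgroup_imp_normal)
qed

lemma comm_group_H2:
  assumes "group G" and "comm_group A"
  shows "comm_group (H2 G A)"
  unfolding H2_def
  using comm_group.abelian_FactGroup[OF comm_group_cocycles2[OF assms]]
    normal_imp_subgroup[OF normal_coboundaries2[OF assms]] by blast

end

theory Submission
  imports
    Defs
    "HOL-Algebra.Group_Action"
    "HOL-Algebra.Multiplicative_Group"
    "HOL-Algebra.SndIsomorphismGrp"
    "HOL-Algebra.Zassenhaus"
begin

text \<open>
  Let \<open>\<Gamma>\<close> be the central extension of \<open>G\<close> by \<open>A = \<complex>\<^sup>\<times>\<close> given by a cocycle \<open>f\<close>. The class of \<open>f\<close> is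
  killed by \<open>M\<close> as soon as the \<open>M\<close>-th power map of \<open>A\<close> extends to a homomorphism \<open>\<Gamma> \<rightarrow> A\<close>.
  Such an extension is built by climbing up the derived series of \<open>\<Gamma>\<close>: let \<open>\<chi> : H \<rightarrow> A\<close> be a
  conjugation invariant homomorphism on a normal subgroup \<open>H\<close>, and let \<open>K \<supseteq> H\<close> be normal with \<open>K/H\<close>
  abelian. Modulo \<open>ker \<chi>\<close> the group \<open>K\<close> has class at most two and its commutators are killed by
  \<open>e = exp G\<close>, so \<open>(x y)\<^sup>m = x\<^sup>m y\<^sup>m [y, x]\<^bsup>m(m-1)/2\<^esup>\<close> shows that \<open>x \<mapsto> \<chi>(x\<^sup>m)\<close> is an
  invariant homomorphism on \<open>K\<close> for \<open>m = e\<close> (\<open>e\<close> odd) or \<open>m = 2 e\<close>. At the last, abelian stage the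
  factor \<open>2\<close> is not needed: \<open>\<chi>\<^sup>e\<close> kills all commutators and extends since \<open>A\<close> is divisible.
\<close>

section \<open>Invariant homomorphisms and powers\<close>

text \<open>Invariance means that \<open>\<chi>\<close> kills every commutator of an element of
  \<open>G\<close> with one of \<open>H\<close>, so \<open>H\<close> is central modulo the kernel of
  \<open>\<chi>\<close>. Tracking values of \<open>\<chi>\<close> replaces computing in that
  quotient.\<close>

locale invariant_hom = normal H G + D: comm_group D for H and G (structure) and D +
  fixes \<chi> :: "'a \<Rightarrow> 'c"
  assumes \<chi>_hom: "\<chi> \<in> hom (G\<lparr>carrier := H\<rparr>) D"
    and \<chi>_conj: "\<lbrakk>g \<in> carrier G; a \<in> H\<rbrakk> \<Longrightarrow> \<chi> (g \<otimes> a \<otimes> inv g) = \<chi> a"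
begin

lemma \<chi>_closed [simp]: "a \<in> H \<Longrightarrow> \<chi> a \<in> carrier D"
  using \<chi>_hom by (auto simp: hom_def)

lemma \<chi>_mult: "\<lbrakk>a \<in> H; b \<in> H\<rbrakk> \<Longrightarrow> \<chi> (a \<otimes> b) = \<chi> a \<otimes>\<^bsub>D\<^esub> \<chi> b"
  using \<chi>_hom by (auto simp: hom_def)

lemma \<chi>_one: "\<chi> \<one> = \<one>\<^bsub>D\<^esub>"
  using \<chi>_mult[of \<one> \<one>] by simp

lemma \<chi>_conj': "\<lbrakk>g \<in> carrier G; a \<in> H\<rbrakk> \<Longrightarrow> \<chi> (inv g \<otimes> a \<otimes> g) = \<chi> a"
  using \<chi>_conj[of "inv g" a] by simp

lemma \<chi>_pow: "a \<in> H \<Longrightarrow> a [^] (n::nat) \<in> H \<and> \<chi> (a [^] n) = \<chi> a [^]\<^bsub>D\<^esub> n"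
  by (induction n) (auto simp: \<chi>_one \<chi>_mult)

text \<open>The conjugate \<open>inv y \<otimes> a \<otimes> y\<close> serves as \<open>b\<close>.
  Elements of \<open>H\<close> can thus be collected on the right without changing their value under
  \<open>\<chi>\<close>.\<close>

lemma move_left:
  assumes "a \<in> H" "y \<in> carrier G"
  shows "\<exists>b\<in>H. a \<otimes> y = y \<otimes> b \<and> \<chi> b = \<chi> a"
proof -
  have "a \<otimes> y = y \<otimes> (inv y \<otimes> a \<otimes> y)"
    using assms by (simp add: m_assoc[symmetric])
  then show ?thesis
    using assms \<chi>_conj' inv_op_closed1 by blast
qed

text \<open>Moving \<open>x\<close> past each factor \<open>y\<close> leaves one copy of
  \<open>w\<close>, and \<open>move_left\<close> collects the copies.\<close>

lemma pow_commute:
  assumes "x \<in> carrier G" "y \<in> carrier G" "w \<in> H" "y \<otimes> x = x \<otimes> y \<otimes> w"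
  shows "\<exists>v\<in>H. y [^] n \<otimes> x = x \<otimes> y [^] n \<otimes> v \<and> \<chi> v = \<chi> w [^]\<^bsub>D\<^esub> (n::nat)"
proof (induction n)
  case 0
  then show ?case
    using assms by (auto simp: \<chi>_one intro!: bexI[of _ \<one>])
next
  case (Suc n)
  then obtain v where v: "v \<in> H" "y [^] n \<otimes> x = x \<otimes> y [^] n \<otimes> v" "\<chi> v = \<chi> w [^]\<^bsub>D\<^esub> n"
    by blast
  obtain u where u: "u \<in> H" "v \<otimes> y = y \<otimes> u" "\<chi> u = \<chi> v"
    using move_left v assms by blast
  have "y [^] Suc n \<otimes> x = (y [^] n \<otimes> x) \<otimes> y \<otimes> w"
    using assms by (simp add: m_assoc)
  also have "\<dots> = x \<otimes> y [^] n \<otimes> (v \<otimes> y) \<otimes> w"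
    using assms v by (simp add: m_assoc)
  also have "\<dots> = x \<otimes> y [^] Suc n \<otimes> (u \<otimes> w)"
    unfolding u using assms v u by (simp add: m_assoc)
  finally show ?case
    using assms u v by (intro bexI[of _ "u \<otimes> w"]) (auto simp: \<chi>_mult)
qed

text \<open>The power formula for groups of class two, read modulo the kernel of
  \<open>\<chi>\<close>. In the induction the new \<open>x\<close> passes \<open>y [^] n\<close> at
  the cost of \<open>n\<close> copies of \<open>w\<close>, and
  \<open>n + (n choose 2) = (Suc n choose 2)\<close>.\<close>

lemma pow_mult_distrib:
  assumes "x \<in> carrier G" "y \<in> carrier G" "w \<in> H" "y \<otimes> x = x \<otimes> y \<otimes> w"
  shows "\<exists>z\<in>H. (x \<otimes> y) [^] n = x [^] n \<otimes> y [^] n \<otimes> z \<and> \<chi> z = \<chi> w [^]\<^bsub>D\<^esub> (n choose 2 :: nat)"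
proof (induction n)
  case 0
  then show ?case
    by (auto simp: \<chi>_one binomial_eq_0 intro!: bexI[of _ \<one>])
next
  case (Suc n)
  then obtain z where z: "z \<in> H" "(x \<otimes> y) [^] n = x [^] n \<otimes> y [^] n \<otimes> z"
      "\<chi> z = \<chi> w [^]\<^bsub>D\<^esub> (n choose 2)"
    by blast
  obtain t where t: "t \<in> H" "z \<otimes> (x \<otimes> y) = x \<otimes> y \<otimes> t" "\<chi> t = \<chi> z"
    using move_left[of z "x \<otimes> y"] z assms by auto
  obtain v where v: "v \<in> H" "y [^] n \<otimes> x = x \<otimes> y [^] n \<otimes> v" "\<chi> v = \<chi> w [^]\<^bsub>D\<^esub> n"
    using pow_commute assms by blast
  obtain u where u: "u \<in> H" "v \<otimes> y = y \<otimes> u" "\<chi> u = \<chi> v"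
    using move_left v assms by blast
  have "(x \<otimes> y) [^] Suc n = x [^] n \<otimes> y [^] n \<otimes> (z \<otimes> (x \<otimes> y))"
    using assms z by (simp add: m_assoc)
  also have "\<dots> = x [^] n \<otimes> (y [^] n \<otimes> x) \<otimes> y \<otimes> t"
    unfolding t using assms z t by (simp add: m_assoc)
  also have "\<dots> = x [^] Suc n \<otimes> y [^] n \<otimes> (v \<otimes> y) \<otimes> t"
    unfolding v using assms v t by (simp add: m_assoc)
  also have "\<dots> = x [^] Suc n \<otimes> y [^] Suc n \<otimes> (u \<otimes> t)"
    unfolding u using assms u t by (simp add: m_assoc)
  finally show ?case
    using assms t u v z
    by (intro bexI[of _ "u \<otimes> t"]) (auto simp: \<chi>_mult D.nat_pow_mult numeral_2_eq_2)
qed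

text \<open>The power \<open>y [^] e\<close> passes \<open>x\<close> in two ways: factor by factor,
  at the cost of the \<open>e\<close>-th power of \<open>\<chi> w\<close>, and as a single element
  of \<open>H\<close>, at no cost.\<close>

lemma commutator_pow_trivial:
  assumes "x \<in> carrier G" "y \<in> carrier G" "w \<in> H" "y \<otimes> x = x \<otimes> y \<otimes> w" "y [^] e \<in> H"
  shows "\<chi> w [^]\<^bsub>D\<^esub> (e::nat) = \<one>\<^bsub>D\<^esub>"
proof -
  obtain v where v: "v \<in> H" "y [^] e \<otimes> x = x \<otimes> y [^] e \<otimes> v" "\<chi> v = \<chi> w [^]\<^bsub>D\<^esub> e"
    using pow_commute[of x y w e] assms by blast
  obtain u where u: "u \<in> H" "y [^] e \<otimes> x = x \<otimes> u" "\<chi> u = \<chi> (y [^] e)"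
    using move_left assms by blast
  have "u = y [^] e \<otimes> v"
    using u v assms by (simp add: m_assoc)
  then show ?thesis
    using u v assms by (simp add: \<chi>_mult)
qed

lemma commutator_obtain:
  assumes "subgroup K G" "derived G K \<subseteq> H" "x \<in> K" "y \<in> K"
  obtains w where "w \<in> H" "y \<otimes> x = x \<otimes> y \<otimes> w"
proof -
  have xy: "x \<in> carrier G" "y \<in> carrier G"
    using assms subgroup.subset by blast+
  \<comment> \<open>Generators of \<open>derived\<close> are products of the shape
    \<open>a \<otimes> b \<otimes> inv a \<otimes> inv b\<close>, so the intended \<open>w\<close>
    is presented as the commutator of \<open>inv y\<close> and \<open>inv x\<close>.\<close>
  have "inv y \<otimes> inv x \<otimes> inv (inv y) \<otimes> inv (inv x) \<in> derived G K"
    unfolding derived_def using assms subgroup.m_inv_closed[OF assms(1)]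
    by (auto intro!: generate.incl)
  then have "inv y \<otimes> inv x \<otimes> y \<otimes> x \<in> H"
    using assms xy by auto
  moreover have "x \<otimes> y \<otimes> (inv y \<otimes> inv x \<otimes> y \<otimes> x) = x \<otimes> (y \<otimes> inv y) \<otimes> inv x \<otimes> y \<otimes> x"
    using xy by (simp add: m_assoc del: r_inv Units_r_inv)
  then have "x \<otimes> y \<otimes> (inv y \<otimes> inv x \<otimes> y \<otimes> x) = y \<otimes> x"
    using xy by simp
  ultimately show ?thesis
    using that by metis
qed

text \<open>One climbing step. That \<open>e\<close> divides \<open>m\<close> puts
  \<open>x [^] m\<close> into \<open>H\<close>; the defect of multiplicativity is the power of
  \<open>\<chi> w\<close> with exponent \<open>m choose 2\<close>, which is trivial because the
  \<open>e\<close>-th power already is.\<close>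

lemma power_hom:
  assumes K: "K \<lhd> G" "derived G K \<subseteq> H"
    and e: "\<And>x. x \<in> K \<Longrightarrow> x [^] e \<in> H" "e dvd m" "e dvd (m choose 2 :: nat)"
  shows "invariant_hom K G D (\<lambda>x. \<chi> (x [^] (m::nat)))"
proof -
  interpret K: normal K G by fact
  have pow: "x [^] m \<in> H" if x: "x \<in> K" for x
  proof -
    obtain q where "m = e * q"
      using e by blast
    then show ?thesis
      using \<chi>_pow[OF e(1)[OF x], of q] x by (simp add: nat_pow_pow)
  qed
  show ?thesis
  proof (unfold_locales, goal_cases)
    case 1
    show ?case
    proof (rule homI, goal_cases)
      case (1 x)
      then show ?case
        using pow by simp
    next
      case (2 x y)
      then have xy: "x \<in> K" "y \<in> K" "x \<in> carrier G" "y \<in> carrier G"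
        by auto
      obtain w where w: "w \<in> H" "y \<otimes> x = x \<otimes> y \<otimes> w"
        using commutator_obtain[OF K.subgroup_axioms K(2) xy(1,2)] .
      obtain z where z: "z \<in> H" "(x \<otimes> y) [^] m = x [^] m \<otimes> y [^] m \<otimes> z"
          "\<chi> z = \<chi> w [^]\<^bsub>D\<^esub> (m choose 2)"
        using pow_mult_distrib[of x y w m] xy w by blast
      have "\<chi> w [^]\<^bsub>D\<^esub> e = \<one>\<^bsub>D\<^esub>"
        using commutator_pow_trivial w xy e by blast
      moreover obtain q where "(m choose 2) = e * q"
        using e by blast
      ultimately have "\<chi> z = \<one>\<^bsub>D\<^esub>"
        using w z by (metis D.nat_pow_one D.nat_pow_pow \<chi>_closed)
      then show ?case
        using xy z pow by (simp add: \<chi>_mult)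
    qed
  next
    case (2 g a)
    then have "(g \<otimes> a \<otimes> inv g) [^] m = g \<otimes> a [^] m \<otimes> inv g"
    proof (induction m)
      case (Suc m)
      then have [simp]: "a \<in> carrier G" by auto
      have "(g \<otimes> a \<otimes> inv g) [^] Suc m = g \<otimes> a [^] m \<otimes> (inv g \<otimes> g) \<otimes> a \<otimes> inv g"
        using Suc by (simp add: m_assoc del: l_inv Units_l_inv)
      then show ?case
        using Suc by (simp add: m_assoc)
    qed simp
    then show ?case
      using 2 pow \<chi>_conj by simp
  qed
qed

end

section \<open>Extension over the derived subgroup\<close>

text \<open>Conjugation alters an element only by a commutator factor, which lies in
  \<open>H\<close> and is killed by \<open>\<psi>\<close>. Above the derived subgroup, normality and
  invariance are therefore automatic at every stage of an extension.\<close>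

lemma (in group) invariant_hom_over_derived:
  assumes "comm_group D" "subgroup H G" "derived G (carrier G) \<subseteq> H"
    and \<psi>: "\<psi> \<in> hom (G\<lparr>carrier := H\<rparr>) D" "\<And>c. c \<in> derived G (carrier G) \<Longrightarrow> \<psi> c = \<one>\<^bsub>D\<^esub>"
  shows "invariant_hom H G D \<psi>"
proof -
  interpret D: comm_group D by fact
  interpret H: subgroup H G by fact
  have comm: "g \<otimes> a \<otimes> inv g \<otimes> inv a \<in> derived G (carrier G)"
    if "g \<in> carrier G" "a \<in> carrier G" for g a
    unfolding derived_def using that by (auto intro!: generate.incl)
  have eq: "g \<otimes> a \<otimes> inv g = (g \<otimes> a \<otimes> inv g \<otimes> inv a) \<otimes> a"
    if "g \<in> carrier G" "a \<in> carrier G" for g a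
    using that by (simp add: m_assoc)
  have \<psi>_mult: "\<psi> (a \<otimes> b) = \<psi> a \<otimes>\<^bsub>D\<^esub> \<psi> b" "\<psi> b \<in> carrier D" if "a \<in> H" "b \<in> H" for a b
    using \<psi>(1) that by (auto simp: hom_def)
  interpret H: normal H G
    unfolding normal_inv_iff using assms(2,3) comm eq H.m_closed H.mem_carrier
    by (metis subsetD)
  show ?thesis
  proof (unfold_locales, goal_cases)
    case (2 g a)
    then have "\<psi> (g \<otimes> a \<otimes> inv g) = \<psi> (g \<otimes> a \<otimes> inv g \<otimes> inv a) \<otimes>\<^bsub>D\<^esub> \<psi> a"
      using comm[of g a] eq[of g a] \<psi>_mult assms(3) by (metis H.mem_carrier subsetD)
    then show ?case
      using 2 comm[of g a] \<psi> \<psi>_mult by auto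
  qed fact
qed

text \<open>Let \<open>k\<close> be the order of \<open>x\<close> modulo \<open>H\<close> and
  \<open>c\<close> a \<open>k\<close>-th root of \<open>\<chi> (x [^] k)\<close>. The extension
  sends \<open>h \<otimes> x [^] i\<close> to \<open>\<chi> h\<close> times the \<open>i\<close>-th
  power of \<open>c\<close>; invariance of \<open>\<chi>\<close> makes it multiplicative.\<close>

lemma (in invariant_hom) extend_adjoin:
  assumes x: "x \<in> carrier G" and "0 < (e::nat)" "x [^] e \<in> H"
    and div: "\<And>a k. \<lbrakk>a \<in> carrier D; 0 < (k::nat)\<rbrakk> \<Longrightarrow> \<exists>c\<in>carrier D. c [^]\<^bsub>D\<^esub> k = a"
  obtains K \<psi> where "subgroup K G" "H \<subseteq> K" "x \<in> K" "\<psi> \<in> hom (G\<lparr>carrier := K\<rparr>) D"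
    "\<And>a. a \<in> H \<Longrightarrow> \<psi> a = \<chi> a"
proof -
  define k where "k = (LEAST k. 0 < k \<and> x [^] (k::nat) \<in> H)"
  have k: "0 < k" "x [^] k \<in> H"
    using LeastI[of "\<lambda>k. 0 < k \<and> x [^] (k::nat) \<in> H" e] assms unfolding k_def by auto
  obtain c where c: "c \<in> carrier D" "c [^]\<^bsub>D\<^esub> k = \<chi> (x [^] k)"
    using div k by (meson \<chi>_closed)
  have \<chi>_int_pow: "a [^] (i::int) \<in> H \<and> \<chi> (a [^] i) = \<chi> a [^]\<^bsub>D\<^esub> i" if "a \<in> H" for a i
  proof -
    interpret gh: group_hom "G\<lparr>carrier := H\<rparr>" D \<chi>
      using \<chi>_hom subgroup_is_group[OF is_group]
      by (simp add: group_hom_def group_hom_axioms_def D.is_group)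
    show ?thesis
      using that gh.hom_int_pow[of a i] int_pow_consistent[OF subgroup_axioms that]
        subgroup_int_pow_closed[OF subgroup_axioms that] by simp
  qed
  \<comment> \<open>This is the compatibility on the intersection of \<open>H\<close> with the
    powers of \<open>x\<close>. By minimality of \<open>k\<close> the remainder of \<open>i\<close>
    modulo \<open>k\<close> vanishes, so \<open>i\<close> is a multiple of \<open>k\<close>.\<close>
  have xi: "\<chi> (x [^] i) = c [^]\<^bsub>D\<^esub> i" if "x [^] i \<in> H" for i :: int
  proof -
    have q: "(x [^] k) [^] (i div int k) \<in> H"
      using \<chi>_int_pow k by blast
    have "x [^] (int k * j + i) = (x [^] k) [^] j \<otimes> x [^] i" for j :: int
      using x by (simp add: int_pow_mult int_pow_pow flip: int_pow_int)
    from this[of "- (i div int k)"] have "x [^] (i mod int k) = (x [^] k) [^] (- (i div int k)) \<otimes> x [^] i"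
      by (simp add: minus_mult_div_eq_mod)
    also have "\<dots> \<in> H"
      using \<chi>_int_pow k that by blast
    finally have "x [^] nat (i mod int k) \<in> H"
      using k by (simp add: pow_nat)
    then have "\<not> 0 < nat (i mod int k)"
      using not_less_Least[of "nat (i mod int k)" "\<lambda>k. 0 < k \<and> x [^] (k::nat) \<in> H"] k
        nat_less_iff[of "i mod int k" k]
      by (auto simp: k_def[symmetric])
    then have "i mod int k = 0"
      using k by (simp add: order_antisym)
    then obtain q where i: "i = int k * q"
      by (metis mod_0_imp_dvd dvd_def)
    have "x [^] i = (x [^] k) [^] q" "c [^]\<^bsub>D\<^esub> i = (c [^]\<^bsub>D\<^esub> k) [^]\<^bsub>D\<^esub> q"
      using x c(1) by (simp_all add: i int_pow_pow D.int_pow_pow flip: int_pow_int)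
    then show ?thesis
      using \<chi>_int_pow[OF k(2), of q] c by simp
  qed
  define K where "K = H <#> generate G {x}"
  have K: "subgroup K G"
    unfolding K_def by (rule mult_norm_subgroup[OF normal_axioms generate_is_subgroup]) (use x in auto)
  have K_iff: "y \<in> K \<longleftrightarrow> (\<exists>h\<in>H. \<exists>i::int. y = h \<otimes> x [^] i)" for y
    using x by (auto simp: K_def set_mult_def generate_pow)
  \<comment> \<open>The representation of \<open>y\<close> need not be unique; the choice ranges
    over all values that arise, and the next fact shows that there is only one.\<close>
  define \<psi> where "\<psi> y = (SOME z. \<exists>h\<in>H. \<exists>i::int. y = h \<otimes> x [^] i \<and> z = \<chi> h \<otimes>\<^bsub>D\<^esub> c [^]\<^bsub>D\<^esub> i)" for y
  have \<psi>: "\<psi> (h \<otimes> x [^] i) = \<chi> h \<otimes>\<^bsub>D\<^esub> c [^]\<^bsub>D\<^esub> i" if h: "h \<in> H" for h and i :: int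
    unfolding \<psi>_def
  proof (rule someI2[of _ "\<chi> h \<otimes>\<^bsub>D\<^esub> c [^]\<^bsub>D\<^esub> i"], use h in blast)
    fix z assume "\<exists>h'\<in>H. \<exists>j::int. h \<otimes> x [^] i = h' \<otimes> x [^] j \<and> z = \<chi> h' \<otimes>\<^bsub>D\<^esub> c [^]\<^bsub>D\<^esub> j"
    then obtain h' and j :: int where h': "h' \<in> H" "h \<otimes> x [^] i = h' \<otimes> x [^] j"
        "z = \<chi> h' \<otimes>\<^bsub>D\<^esub> c [^]\<^bsub>D\<^esub> j"
      by blast
    have "h \<otimes> x [^] (i - j) = h'"
      using h h' x by (simp add: int_pow_diff m_assoc[symmetric])
        (simp add: m_assoc)
    then have "x [^] (i - j) = inv h \<otimes> h'"
      using h h' x by (metis inv_solve_left' int_pow_closed mem_carrier)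
    then have *: "x [^] (i - j) \<in> H"
      using h h' by simp
    have "z = \<chi> (h \<otimes> x [^] (i - j)) \<otimes>\<^bsub>D\<^esub> c [^]\<^bsub>D\<^esub> j"
      using h' \<open>h \<otimes> x [^] (i - j) = h'\<close> by simp
    also have "\<dots> = \<chi> h \<otimes>\<^bsub>D\<^esub> (c [^]\<^bsub>D\<^esub> (i - j) \<otimes>\<^bsub>D\<^esub> c [^]\<^bsub>D\<^esub> j)"
      using h * c by (simp add: \<chi>_mult xi D.m_assoc)
    also have "\<dots> = \<chi> h \<otimes>\<^bsub>D\<^esub> c [^]\<^bsub>D\<^esub> i"
      using c by (simp flip: D.int_pow_mult)
    finally show "z = \<chi> h \<otimes>\<^bsub>D\<^esub> c [^]\<^bsub>D\<^esub> i" .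
  qed
  show ?thesis
  proof
    show "subgroup K G" by fact
    show "H \<subseteq> K"
    proof
      fix h assume "h \<in> H"
      then show "h \<in> K"
        unfolding K_iff by (intro bexI[of _ h] exI[of _ "0::int"]) auto
    qed
    show "x \<in> K"
      unfolding K_iff using x by (intro bexI[of _ \<one>] exI[of _ "1::int"]) auto
    show "\<psi> a = \<chi> a" if "a \<in> H" for a
      using \<psi>[OF that, of 0] that by simp
    show "\<psi> \<in> hom (G\<lparr>carrier := K\<rparr>) D"
    proof (rule homI, goal_cases)
      case (1 y)
      then show ?case
        using c by (auto simp: K_iff \<psi>)
    next
      case (2 y z)
      then obtain h h' and i j :: int where h: "h \<in> H" "h' \<in> H"
        and yz: "y = h \<otimes> x [^] i" "z = h' \<otimes> x [^] j"
        by (auto simp: K_iff)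
      have *: "x [^] i \<otimes> h' \<otimes> inv (x [^] i) \<in> H"
        using h x by (intro inv_op_closed2) auto
      \<comment> \<open>Inserting \<open>inv (x [^] i) \<otimes> x [^] i\<close> brings the product
        into the form of an element of \<open>H\<close> times a power of \<open>x\<close>.\<close>
      have "y \<otimes> z = h \<otimes> (x [^] i \<otimes> h' \<otimes> (inv (x [^] i) \<otimes> x [^] i)) \<otimes> x [^] j"
        using h x by (simp add: yz m_assoc)
      also have "\<dots> = (h \<otimes> (x [^] i \<otimes> h' \<otimes> inv (x [^] i))) \<otimes> x [^] (i + j)"
        using h x by (simp add: m_assoc int_pow_mult del: l_inv Units_l_inv)
      finally have "\<psi> (y \<otimes> z) = \<chi> h \<otimes>\<^bsub>D\<^esub> \<chi> h' \<otimes>\<^bsub>D\<^esub> (c [^]\<^bsub>D\<^esub> i \<otimes>\<^bsub>D\<^esub> c [^]\<^bsub>D\<^esub> j)"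
        using h x * c by (simp add: \<psi> \<chi>_mult \<chi>_conj D.int_pow_mult)
      then show ?case
        using h c by (simp add: yz \<psi> D.m_ac)
    qed
  qed
qed

text \<open>The elements of the finite set \<open>S\<close> are adjoined one at a time. Each
  extension agrees with \<open>\<chi>\<close> on \<open>H\<close>, hence stays trivial on the
  derived subgroup, so \<open>invariant_hom_over_derived\<close> applies again.\<close>

lemma (in group) extend_over_derived:
  assumes D: "comm_group D" and H: "subgroup H G" "derived G (carrier G) \<subseteq> H"
    and \<chi>: "\<chi> \<in> hom (G\<lparr>carrier := H\<rparr>) D" "\<And>c. c \<in> derived G (carrier G) \<Longrightarrow> \<chi> c = \<one>\<^bsub>D\<^esub>"
    and div: "\<And>a k. \<lbrakk>a \<in> carrier D; 0 < (k::nat)\<rbrakk> \<Longrightarrow> \<exists>c\<in>carrier D. c [^]\<^bsub>D\<^esub> k = a"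
    and e: "0 < (e::nat)" "\<And>x. x \<in> carrier G \<Longrightarrow> x [^] e \<in> H"
    and S: "finite S" "S \<subseteq> carrier G" "carrier G \<subseteq> H <#> S"
  obtains \<psi> where "\<psi> \<in> hom G D" "\<And>a. a \<in> H \<Longrightarrow> \<psi> a = \<chi> a"
proof -
  have "\<exists>K \<psi>. subgroup K G \<and> H \<subseteq> K \<and> S \<subseteq> K \<and> \<psi> \<in> hom (G\<lparr>carrier := K\<rparr>) D \<and>
      (\<forall>a\<in>H. \<psi> a = \<chi> a)"
    using S(1,2)
  proof (induction S)
    case empty
    then show ?case
      using H \<chi> by blast
  next
    case (insert x S)
    then obtain K \<psi> where K: "subgroup K G" "H \<subseteq> K" "S \<subseteq> K" "\<psi> \<in> hom (G\<lparr>carrier := K\<rparr>) D"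
      "\<forall>a\<in>H. \<psi> a = \<chi> a"
      by auto
    interpret K: invariant_hom K G D \<psi>
      by (rule invariant_hom_over_derived) (use D H K \<chi> in auto)
    obtain K' \<psi>' where "subgroup K' G" "K \<subseteq> K'" "x \<in> K'" "\<psi>' \<in> hom (G\<lparr>carrier := K'\<rparr>) D"
      "\<And>a. a \<in> K \<Longrightarrow> \<psi>' a = \<psi> a"
      using K.extend_adjoin[OF _ e(1) _ div, of x] insert.prems e K by blast
    then show ?case
      using K by (intro exI[of _ K'] exI[of _ \<psi>']) auto
  qed
  then obtain K \<psi> where K: "subgroup K G" "H \<subseteq> K" "S \<subseteq> K" "\<psi> \<in> hom (G\<lparr>carrier := K\<rparr>) D"
    "\<forall>a\<in>H. \<psi> a = \<chi> a"
    by blast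
  have "H <#> S \<subseteq> K"
    using K subgroup.m_closed[OF K(1)] unfolding set_mult_def by blast
  then have "carrier G \<subseteq> K"
    using S by blast
  then have "K = carrier G"
    using K subgroup.subset by blast
  then show ?thesis
    using that K by auto
qed

section \<open>Climbing the derived series\<close>

lemma (in group) exp_of_derived_is_normal: "(derived G ^^ n) (carrier G) \<lhd> G"
  by (induction n) (auto simp: normal_self derived_is_normal)

text \<open>In the quotient by \<open>H\<close> the image of \<open>H <#> U\<close> lies in that of
  \<open>U\<close>, whose derived subgroup has trivial image.\<close>

lemma (in group) derived_set_mult_subset:
  assumes H: "H \<lhd> G" and U: "U \<subseteq> carrier G" "derived G U \<subseteq> H"
  shows "derived G (H <#> U) \<subseteq> H"
proof -
  interpret H: normal H G by fact
  interpret h: group_hom G "G Mod H" "\<lambda>x. H #> x"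
    using H.r_coset_hom_Mod H.factorgroup_is_group
    by (simp add: group_hom_def group_hom_axioms_def)
  have one: "H #> x = H \<longleftrightarrow> x \<in> H" if "x \<in> carrier G" for x
    using that coset_join1 coset_join2 H.subgroup_axioms by blast
  have HU: "H <#> U \<subseteq> carrier G"
    using H.subset U set_mult_closed by simp
  have "H #> (h \<otimes> u) = H #> u" if "h \<in> H" "u \<in> U" for h u
    using that U(1) H.subset one[of h] by (metis H.mem_carrier coset_mult_assoc subsetD)
  then have "(\<lambda>x. H #> x) ` (H <#> U) \<subseteq> (\<lambda>x. H #> x) ` U"
    by (auto simp: set_mult_def)
  then have "(\<lambda>x. H #> x) ` derived G (H <#> U) \<subseteq> (\<lambda>x. H #> x) ` derived G U"
    using h.H.mono_derived by (simp flip: h.derived_img add: HU U)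
  moreover have "(\<lambda>x. H #> x) ` derived G U \<subseteq> {H}"
    using U one derived_in_carrier by blast
  ultimately have *: "(\<lambda>x. H #> x) ` derived G (H <#> U) \<subseteq> {H}"
    by (rule subset_trans)
  show ?thesis
  proof
    fix x assume x: "x \<in> derived G (H <#> U)"
    then have "x \<in> carrier G" "H #> x = H"
      using derived_in_carrier[OF HU] * by auto
    then show "x \<in> H"
      using one by simp
  qed
qed

text \<open>Induction on \<open>d\<close> with \<open>H\<close> and \<open>\<chi>\<close> varying:
  each climb to a larger \<open>K\<close> costs a factor \<open>m\<close>, and the final extension
  from a subgroup containing the derived subgroup costs only \<open>e\<close>.\<close>

lemma (in invariant_hom) exists_extension_of_power:
  assumes div: "\<And>a k. \<lbrakk>a \<in> carrier D; 0 < (k::nat)\<rbrakk> \<Longrightarrow> \<exists>c\<in>carrier D. c [^]\<^bsub>D\<^esub> k = a"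
    and e: "0 < (e::nat)" "\<And>x. x \<in> carrier G \<Longrightarrow> x [^] e \<in> H"
    and m: "e dvd m" "e dvd (m choose 2)"
    and S: "finite S" "S \<subseteq> carrier G" "carrier G \<subseteq> H <#> S"
    and d: "(derived G ^^ Suc d) (carrier G) \<subseteq> H"
  shows "\<exists>\<psi>. \<psi> \<in> hom G D \<and> (\<forall>a\<in>H. \<psi> a = \<chi> a [^]\<^bsub>D\<^esub> (m ^ d * e :: nat))"
  using invariant_hom_axioms e(2) S(3) d
proof (induction d arbitrary: H \<chi>)
  case 0
  interpret invariant_hom H G D \<chi> by fact
  \<comment> \<open>The elements of \<open>H\<close> killed by the \<open>e\<close>-th power of
    \<open>\<chi>\<close> form a subgroup, so it suffices to treat single commutators.\<close>
  have ker: "derived G (carrier G) \<subseteq> {c \<in> H. \<chi> c [^]\<^bsub>D\<^esub> e = \<one>\<^bsub>D\<^esub>}"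
    unfolding derived_def
  proof (rule generate_subgroup_incl)
    show "subgroup {c \<in> H. \<chi> c [^]\<^bsub>D\<^esub> e = \<one>\<^bsub>D\<^esub>} G"
    proof (unfold_locales, goal_cases)
      case (4 x)
      then have "\<chi> (inv x) [^]\<^bsub>D\<^esub> e = (\<chi> (inv x) \<otimes>\<^bsub>D\<^esub> \<chi> x) [^]\<^bsub>D\<^esub> e"
        by (auto simp: D.nat_pow_distrib)
      then show ?case
        using 4 by (simp add: \<chi>_one flip: \<chi>_mult)
    qed (auto simp: \<chi>_mult \<chi>_one D.nat_pow_distrib)
    show "derived_set G (carrier G) \<subseteq> {c \<in> H. \<chi> c [^]\<^bsub>D\<^esub> e = \<one>\<^bsub>D\<^esub>}"
    proof clarsimp
      fix x y assume xy: "x \<in> carrier G" "y \<in> carrier G"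
      let ?w = "x \<otimes> y \<otimes> inv x \<otimes> inv y"
      have "?w \<in> derived G (carrier G)"
        unfolding derived_def using xy by (auto intro!: generate.incl)
      then have w: "?w \<in> H"
        using 0 by auto
      \<comment> \<open>Since \<open>?w \<otimes> (y \<otimes> x) = x \<otimes> y\<close>, shifting
        \<open>?w\<close> to the right gives the form required by
        \<open>commutator_pow_trivial\<close>, with the same value under
        \<open>\<chi>\<close>.\<close>
      obtain v where v: "v \<in> H" "?w \<otimes> (y \<otimes> x) = y \<otimes> x \<otimes> v" "\<chi> v = \<chi> ?w"
        using move_left[OF w, of "y \<otimes> x"] xy by auto
      have "?w \<otimes> (y \<otimes> x) = x \<otimes> y \<otimes> (inv x \<otimes> (inv y \<otimes> y) \<otimes> x)"
        using xy by (simp add: m_assoc del: l_inv Units_l_inv)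
      then have "x \<otimes> y = y \<otimes> x \<otimes> v"
        using v xy by simp
      then have "\<chi> v [^]\<^bsub>D\<^esub> e = \<one>\<^bsub>D\<^esub>"
        using commutator_pow_trivial[of y x v e] v xy 0 by blast
      then show "?w \<in> H \<and> \<chi> ?w [^]\<^bsub>D\<^esub> e = \<one>\<^bsub>D\<^esub>"
        using w v by simp
    qed
  qed
  have "(\<lambda>a. \<chi> a [^]\<^bsub>D\<^esub> e) \<in> hom (G\<lparr>carrier := H\<rparr>) D"
    by (auto simp: hom_def \<chi>_mult D.nat_pow_distrib)
  then obtain \<psi> where "\<psi> \<in> hom G D" "\<And>a. a \<in> H \<Longrightarrow> \<psi> a = \<chi> a [^]\<^bsub>D\<^esub> e"
    using extend_over_derived[OF D.comm_group_axioms subgroup_axioms _ _ _ div e(1) _ S(1,2), of "\<lambda>a. \<chi> a [^]\<^bsub>D\<^esub> e"]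
      ker 0 by blast
  then show ?case
    by auto
next
  case (Suc d)
  interpret invariant_hom H G D \<chi> by fact
  \<comment> \<open>This term of the derived series lies one step above the one contained in
    \<open>H\<close>, so the product \<open>K\<close> of \<open>H\<close> and \<open>U\<close> is
    abelian modulo \<open>H\<close>.\<close>
  define U where "U = (derived G ^^ Suc d) (carrier G)"
  have U: "U \<lhd> G" "derived G U \<subseteq> H" "U \<subseteq> carrier G"
    using exp_of_derived_is_normal Suc.prems exp_of_derived_in_carrier[of "carrier G"]
    by (auto simp: U_def simp del: funpow.simps simp: funpow.simps(2)[of "Suc d"])
  interpret U: normal U G by fact
  define K where "K = H <#> U"
  have KG: "K \<lhd> G" "derived G K \<subseteq> H"
    unfolding K_def using normal_subgroup_set_mult_closed[OF normal_axioms U(1)]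
      derived_set_mult_subset[OF normal_axioms U(3,2)] by auto
  interpret K: normal K G by fact
  have HUK: "h \<otimes> u \<in> K" if "h \<in> H" "u \<in> U" for h u
    unfolding K_def set_mult_def by (rule UN_I[OF that(1)], rule UN_I[OF that(2)], rule singletonI)
  have HK: "H \<subseteq> K"
    using HUK[OF _ U.one_closed] by auto
  have UK: "U \<subseteq> K"
    using HUK[OF one_closed] by auto
  have inv: "invariant_hom K G D (\<lambda>x. \<chi> (x [^] m))"
    by (rule power_hom[OF KG _ m]) (use Suc.prems in auto)
  have "H <#> S \<subseteq> K <#> S"
    unfolding set_mult_def by (intro UN_mono HK order_refl)
  then have "\<exists>\<psi>. \<psi> \<in> hom G D \<and> (\<forall>a\<in>K. \<psi> a = \<chi> (a [^] m) [^]\<^bsub>D\<^esub> (m ^ d * e))"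
    by (intro Suc.IH[OF inv]) (use Suc.prems HK UK U_def in \<open>blast+\<close>)
  then obtain \<psi> where \<psi>: "\<psi> \<in> hom G D" "\<forall>a\<in>K. \<psi> a = \<chi> (a [^] m) [^]\<^bsub>D\<^esub> (m ^ d * e)"
    by blast
  \<comment> \<open>On \<open>H\<close> the inner power \<open>m\<close> comes out of
    \<open>\<chi>\<close> and raises the exponent of \<open>m\<close> by one.\<close>
  have "\<psi> a = \<chi> a [^]\<^bsub>D\<^esub> (m ^ Suc d * e)" if "a \<in> H" for a
    using \<psi>(2) HK that \<chi>_pow[OF that, of m] by (auto simp: D.nat_pow_pow ac_simps)
  with \<psi>(1) show ?case
    by (intro exI[of _ \<psi>] conjI ballI)
qed

section \<open>The extension defined by a cocycle\<close>

text \<open>Cocycles need not be normalised, whence the shape of the unit.\<close>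

definition cocycle_extension ::
  "('a, 'b) monoid_scheme \<Rightarrow> ('c, 'd) monoid_scheme \<Rightarrow> ('a \<times> 'a \<Rightarrow> 'c) \<Rightarrow> ('c \<times> 'a) monoid" where
  "cocycle_extension G A f =
     \<lparr>carrier = carrier A \<times> carrier G,
      monoid.mult = (\<lambda>(a, g) (b, h). (a \<otimes>\<^bsub>A\<^esub> b \<otimes>\<^bsub>A\<^esub> f (g, h), g \<otimes>\<^bsub>G\<^esub> h)),
      one = (inv\<^bsub>A\<^esub> f (\<one>\<^bsub>G\<^esub>, \<one>\<^bsub>G\<^esub>), \<one>\<^bsub>G\<^esub>)\<rparr>"

locale cocycle = G: group G + A: comm_group A for G (structure) and A +
  fixes f :: "'a \<times> 'a \<Rightarrow> 'c"
  assumes cocycle: "f \<in> cocycles2 G A"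
begin

abbreviation E where "E \<equiv> cocycle_extension G A f"

lemma f_closed [simp]: "\<lbrakk>g \<in> carrier G; h \<in> carrier G\<rbrakk> \<Longrightarrow> f (g, h) \<in> carrier A"
  using cocycle by (auto simp: cocycles2_def kernel_def cochains2_def PiE_iff)

lemma cocycle_eq:
  assumes "g \<in> carrier G" "h \<in> carrier G" "k \<in> carrier G"
  shows "f (g, h) \<otimes>\<^bsub>A\<^esub> f (g \<otimes> h, k) = f (h, k) \<otimes>\<^bsub>A\<^esub> f (g, h \<otimes> k)"
proof -
  have "coboundary2 G A f = \<one>\<^bsub>cochains3 G A\<^esub>"
    using cocycle by (auto simp: cocycles2_def kernel_def)
  then have "coboundary2 G A f (g, h, k) = \<one>\<^bsub>A\<^esub>"
    using assms by (simp add: cochains3_def)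
  then have "f (h, k) \<otimes>\<^bsub>A\<^esub> inv\<^bsub>A\<^esub> f (g \<otimes> h, k) \<otimes>\<^bsub>A\<^esub> f (g, h \<otimes> k) \<otimes>\<^bsub>A\<^esub> inv\<^bsub>A\<^esub> f (g, h) = \<one>\<^bsub>A\<^esub>"
    using assms by (simp add: coboundary2_def)
  then have "f (h, k) \<otimes>\<^bsub>A\<^esub> inv\<^bsub>A\<^esub> f (g \<otimes> h, k) \<otimes>\<^bsub>A\<^esub> f (g, h \<otimes> k) = f (g, h)"
    using assms A.inv_equality[of "f (h, k) \<otimes>\<^bsub>A\<^esub> inv\<^bsub>A\<^esub> f (g \<otimes> h, k) \<otimes>\<^bsub>A\<^esub> f (g, h \<otimes> k)" "inv\<^bsub>A\<^esub> f (g, h)", symmetric]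
    by simp
  then have "f (g, h) \<otimes>\<^bsub>A\<^esub> f (g \<otimes> h, k) =
      (f (g \<otimes> h, k) \<otimes>\<^bsub>A\<^esub> inv\<^bsub>A\<^esub> f (g \<otimes> h, k)) \<otimes>\<^bsub>A\<^esub> (f (h, k) \<otimes>\<^bsub>A\<^esub> f (g, h \<otimes> k))"
    using assms by (simp add: A.m_ac del: A.r_inv A.Units_r_inv A.l_inv A.Units_l_inv)
  then show ?thesis
    using assms by simp
qed

lemma f_one_left: "g \<in> carrier G \<Longrightarrow> f (\<one>, g) = f (\<one>, \<one>)"
  using cocycle_eq[of \<one> \<one> g] by simp

lemma f_one_right: "g \<in> carrier G \<Longrightarrow> f (g, \<one>) = f (\<one>, \<one>)"
  using cocycle_eq[of g \<one> \<one>] by simp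

lemma E_carrier: "carrier E = carrier A \<times> carrier G"
  and E_mult: "(a, g) \<otimes>\<^bsub>E\<^esub> (b, h) = (a \<otimes>\<^bsub>A\<^esub> b \<otimes>\<^bsub>A\<^esub> f (g, h), g \<otimes> h)"
  and E_one: "\<one>\<^bsub>E\<^esub> = (inv\<^bsub>A\<^esub> f (\<one>, \<one>), \<one>)"
  by (simp_all add: cocycle_extension_def)

text \<open>Associativity is exactly the cocycle identity.\<close>

lemma group_E: "group E"
proof (rule groupI)
  fix x y z assume "x \<in> carrier E" "y \<in> carrier E" "z \<in> carrier E"
  then obtain a g b h c k where xyz: "x = (a, g)" "y = (b, h)" "z = (c, k)"
    and carr: "a \<in> carrier A" "b \<in> carrier A" "c \<in> carrier A"
      "g \<in> carrier G" "h \<in> carrier G" "k \<in> carrier G"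
    by (auto simp: E_carrier)
  have "a \<otimes>\<^bsub>A\<^esub> b \<otimes>\<^bsub>A\<^esub> f (g, h) \<otimes>\<^bsub>A\<^esub> c \<otimes>\<^bsub>A\<^esub> f (g \<otimes> h, k)
      = a \<otimes>\<^bsub>A\<^esub> b \<otimes>\<^bsub>A\<^esub> c \<otimes>\<^bsub>A\<^esub> (f (g, h) \<otimes>\<^bsub>A\<^esub> f (g \<otimes> h, k))"
    using carr by (simp add: A.m_ac)
  also have "\<dots> = a \<otimes>\<^bsub>A\<^esub> (b \<otimes>\<^bsub>A\<^esub> c \<otimes>\<^bsub>A\<^esub> f (h, k)) \<otimes>\<^bsub>A\<^esub> f (g, h \<otimes> k)"
    using carr by (simp add: cocycle_eq A.m_ac)
  finally show "x \<otimes>\<^bsub>E\<^esub> y \<otimes>\<^bsub>E\<^esub> z = x \<otimes>\<^bsub>E\<^esub> (y \<otimes>\<^bsub>E\<^esub> z)"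
    using carr by (simp add: xyz E_mult G.m_assoc)
next
  fix x assume "x \<in> carrier E"
  then obtain a g where x: "x = (a, g)" and carr: "a \<in> carrier A" "g \<in> carrier G"
    by (auto simp: E_carrier)
  show "\<one>\<^bsub>E\<^esub> \<otimes>\<^bsub>E\<^esub> x = x"
    using carr A.m_comm[of "inv\<^bsub>A\<^esub> f (\<one>, \<one>)" a]
    by (simp add: x E_mult E_one f_one_left[of g] A.m_assoc)
  \<comment> \<open>The first component solves \<open>?y \<otimes> x = \<one>\<close> in the
    extension, whose unit has first component \<open>inv f (\<one>, \<one>)\<close>.\<close>
  let ?y = "(inv\<^bsub>A\<^esub> f (\<one>, \<one>) \<otimes>\<^bsub>A\<^esub> inv\<^bsub>A\<^esub> (a \<otimes>\<^bsub>A\<^esub> f (inv g, g)), inv g)"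
  have "?y \<otimes>\<^bsub>E\<^esub> x = \<one>\<^bsub>E\<^esub>"
    using carr A.l_inv[of "a \<otimes>\<^bsub>A\<^esub> f (inv g, g)"]
    by (simp add: x E_mult E_one A.m_assoc)
  then show "\<exists>y\<in>carrier E. y \<otimes>\<^bsub>E\<^esub> x = \<one>\<^bsub>E\<^esub>"
    using carr by (intro bexI[of _ ?y]) (auto simp: E_carrier)
qed (auto simp: E_carrier E_mult E_one)

sublocale E: group E
  by (rule group_E)

sublocale snd: group_hom E G snd
  by unfold_locales (auto simp: hom_def E_carrier E_mult)

text \<open>The extension is central because \<open>f (\<one>, g)\<close> and
  \<open>f (g, \<one>)\<close> both equal \<open>f (\<one>, \<one>)\<close>.\<close>

lemma kernel_commute:
  assumes "x \<in> carrier E" "y \<in> kernel E G snd"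
  shows "x \<otimes>\<^bsub>E\<^esub> y = y \<otimes>\<^bsub>E\<^esub> x"
proof -
  obtain b g a where "x = (b, g)" "y = (a, \<one>)" "b \<in> carrier A" "a \<in> carrier A" "g \<in> carrier G"
    using assms by (auto simp: kernel_def E_carrier)
  then show ?thesis
    by (simp add: E_mult f_one_left[of g] f_one_right[of g] A.m_comm)
qed

text \<open>The map identifies the kernel with \<open>A\<close>; the factor
  \<open>f (\<one>, \<one>)\<close> compensates for the unnormalised product. Invariance is
  centrality.\<close>

lemma invariant_hom_kernel:
  "invariant_hom (kernel E G snd) E A (\<lambda>(a, g). a \<otimes>\<^bsub>A\<^esub> f (\<one>, \<one>))"
proof -
  interpret K: normal "kernel E G snd" E
    by (rule snd.normal_kernel)
  show ?thesis
  proof (unfold_locales, goal_cases)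
    case 1
    show ?case
      by (rule homI) (auto simp: kernel_def E_carrier E_mult A.m_ac)
  next
    case (2 g a)
    then have "g \<otimes>\<^bsub>E\<^esub> a \<otimes>\<^bsub>E\<^esub> inv\<^bsub>E\<^esub> g = a \<otimes>\<^bsub>E\<^esub> (g \<otimes>\<^bsub>E\<^esub> inv\<^bsub>E\<^esub> g)"
      using kernel_commute[of g a] by (simp add: E.m_assoc)
    then show ?case
      using 2 by simp
  qed
qed

text \<open>If \<open>\<psi>\<close> on the whole extension restricts to the \<open>M\<close>-th
  power of this identification, its values on the section sending \<open>g\<close> to the pair of
  \<open>\<one>\<close> and \<open>g\<close> form a 1-cochain with coboundary the
  \<open>M\<close>-th power of \<open>f\<close>.\<close>

lemma pow_in_coboundaries2:
  assumes div: "\<And>a k. \<lbrakk>a \<in> carrier A; 0 < (k::nat)\<rbrakk> \<Longrightarrow> \<exists>c\<in>carrier A. c [^]\<^bsub>A\<^esub> k = a"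
    and fin: "finite (carrier G)"
    and e: "0 < (e::nat)" "\<And>x. x \<in> carrier G \<Longrightarrow> x [^] e = \<one>"
    and m: "e dvd m" "e dvd (m choose 2)"
    and d: "(derived G ^^ Suc d) (carrier G) = {\<one>}"
  shows "f [^]\<^bsub>cochains2 G A\<^esub> (m ^ d * e :: nat) \<in> coboundaries2 G A"
proof -
  define S where "S = (\<lambda>g. (\<one>\<^bsub>A\<^esub>, g)) ` carrier G"
  define M where "M = m ^ d * e"
  have "\<exists>\<psi>. \<psi> \<in> hom E A \<and> (\<forall>a\<in>kernel E G snd. \<psi> a = (case a of (a, g) \<Rightarrow> a \<otimes>\<^bsub>A\<^esub> f (\<one>, \<one>)) [^]\<^bsub>A\<^esub> M)"
    unfolding M_def
  proof (rule invariant_hom.exists_extension_of_power[OF invariant_hom_kernel div e(1) _ m])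
    show "x [^]\<^bsub>E\<^esub> e \<in> kernel E G snd" if "x \<in> carrier E" for x
      using that e(2)[OF snd.hom_closed[OF that]] by (simp add: kernel_def snd.hom_nat_pow)
    show "finite S" "S \<subseteq> carrier E"
      using fin by (auto simp: S_def E_carrier)
    show "carrier E \<subseteq> kernel E G snd <#>\<^bsub>E\<^esub> S"
    proof
      fix x assume "x \<in> carrier E"
      then obtain a g where x: "x = (a, g)" "a \<in> carrier A" "g \<in> carrier G"
        by (auto simp: E_carrier)
      have "x = (a \<otimes>\<^bsub>A\<^esub> inv\<^bsub>A\<^esub> f (\<one>, \<one>), \<one>) \<otimes>\<^bsub>E\<^esub> (\<one>\<^bsub>A\<^esub>, g)"
        using x by (simp add: E_mult f_one_left[of g] A.m_assoc)
      moreover have "(a \<otimes>\<^bsub>A\<^esub> inv\<^bsub>A\<^esub> f (\<one>, \<one>), \<one>) \<in> kernel E G snd" "(\<one>\<^bsub>A\<^esub>, g) \<in> S"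
        using x by (auto simp: kernel_def E_carrier S_def)
      ultimately show "x \<in> kernel E G snd <#>\<^bsub>E\<^esub> S"
        unfolding set_mult_def by blast
    qed
    \<comment> \<open>The projection is onto, hence maps the derived series of \<open>E\<close> onto
      that of \<open>G\<close>.\<close>
    have "snd ` carrier E = carrier G"
      using A.one_closed by (force simp: E_carrier)
    then have "snd ` (derived E ^^ Suc d) (carrier E) = {\<one>}"
      using snd.exp_of_derived_img[of "carrier E" "Suc d"] d by simp
    then show "(derived E ^^ Suc d) (carrier E) \<subseteq> kernel E G snd"
      using E.exp_of_derived_in_carrier[of "carrier E" "Suc d"] by (auto simp: kernel_def)
  qed
  then obtain \<psi> where \<psi>: "\<psi> \<in> hom E A"
      "\<And>a. a \<in> carrier A \<Longrightarrow> \<psi> (a, \<one>) = (a \<otimes>\<^bsub>A\<^esub> f (\<one>, \<one>)) [^]\<^bsub>A\<^esub> M"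
    by (auto simp: kernel_def E_carrier)
  define c where "c = (\<lambda>g\<in>carrier G. \<psi> (\<one>\<^bsub>A\<^esub>, g))"
  have \<psi>_closed: "\<psi> (\<one>\<^bsub>A\<^esub>, g) \<in> carrier A" if "g \<in> carrier G" for g
    using \<psi>(1) that by (auto simp: hom_def E_carrier)
  have "f (g, h) [^]\<^bsub>A\<^esub> M = \<psi> (\<one>\<^bsub>A\<^esub>, h) \<otimes>\<^bsub>A\<^esub> inv\<^bsub>A\<^esub> (\<psi> (\<one>\<^bsub>A\<^esub>, g \<otimes> h)) \<otimes>\<^bsub>A\<^esub> \<psi> (\<one>\<^bsub>A\<^esub>, g)"
    if gh: "g \<in> carrier G" "h \<in> carrier G" for g h
  proof -
    \<comment> \<open>This kernel element corresponds to \<open>f (g, h)\<close> in \<open>A\<close>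
      and measures the failure of the section to be multiplicative.\<close>
    let ?z = "(f (g, h) \<otimes>\<^bsub>A\<^esub> inv\<^bsub>A\<^esub> f (\<one>, \<one>), \<one>)"
    have "?z \<otimes>\<^bsub>E\<^esub> (\<one>\<^bsub>A\<^esub>, g \<otimes> h) = (\<one>\<^bsub>A\<^esub>, g) \<otimes>\<^bsub>E\<^esub> (\<one>\<^bsub>A\<^esub>, h)"
      using gh by (simp add: E_mult f_one_left[of "g \<otimes> h"] A.m_assoc)
    then have "\<psi> ?z \<otimes>\<^bsub>A\<^esub> \<psi> (\<one>\<^bsub>A\<^esub>, g \<otimes> h) = \<psi> (\<one>\<^bsub>A\<^esub>, g) \<otimes>\<^bsub>A\<^esub> \<psi> (\<one>\<^bsub>A\<^esub>, h)"
      using gh \<psi>(1) by (simp add: E_carrier flip: hom_mult[OF \<psi>(1)])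
    moreover have "\<psi> ?z = f (g, h) [^]\<^bsub>A\<^esub> M"
      using gh by (simp add: \<psi>(2) A.m_assoc)
    ultimately have "f (g, h) [^]\<^bsub>A\<^esub> M = \<psi> (\<one>\<^bsub>A\<^esub>, g) \<otimes>\<^bsub>A\<^esub> \<psi> (\<one>\<^bsub>A\<^esub>, h) \<otimes>\<^bsub>A\<^esub> inv\<^bsub>A\<^esub> \<psi> (\<one>\<^bsub>A\<^esub>, g \<otimes> h)"
      using gh \<psi>_closed by (intro A.inv_solve_right[THEN iffD2]) auto
    then show ?thesis
      using gh \<psi>_closed by (simp add: A.m_ac)
  qed
  moreover have pow: "f [^]\<^bsub>cochains2 G A\<^esub> n = (\<lambda>x\<in>carrier G \<times> carrier G. f x [^]\<^bsub>A\<^esub> n)" for n :: nat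
    by (induction n) (auto simp: cochains2_def)
  ultimately have "f [^]\<^bsub>cochains2 G A\<^esub> M = coboundary1 G A c"
    by (auto simp: coboundary1_def c_def intro!: restrict_ext)
  moreover have "c \<in> carrier (cochains1 G A)"
    using \<psi>_closed by (auto simp: c_def cochains1_def)
  ultimately show ?thesis
    unfolding coboundaries2_def M_def by blast
qed

end

section \<open>Solvability of finite p-groups\<close>

lemma (in group) subgroup_center: "subgroup {z \<in> carrier G. \<forall>g\<in>carrier G. g \<otimes> z = z \<otimes> g} G"
proof (unfold_locales, goal_cases)
  case (2 x y)
  then have xy: "x \<in> carrier G" "y \<in> carrier G"
    by auto
  have "g \<otimes> (x \<otimes> y) = x \<otimes> y \<otimes> g" if g: "g \<in> carrier G" for g
  proof -
    have "g \<otimes> x = x \<otimes> g" "g \<otimes> y = y \<otimes> g"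
      using 2 g by blast+
    then show ?thesis
      using xy g by (metis m_assoc)
  qed
  with xy show ?case
    by simp
next
  case (4 x)
  then have x: "x \<in> carrier G"
    by auto
  have "g \<otimes> inv x = inv x \<otimes> g" if g: "g \<in> carrier G" for g
  proof -
    have "g \<otimes> x = x \<otimes> g"
      using 4 g by blast
    then show ?thesis
      using x g by (metis inv_closed inv_solve_left inv_solve_right m_assoc m_closed)
  qed
  with x show ?case
    by simp
qed auto

text \<open>Class equation: were only \<open>\<one>\<close> central, every other conjugacy class
  would have size divisible by \<open>p\<close>, giving \<open>order G\<close> the remainder 1
  modulo \<open>p\<close>.\<close>

lemma (in group) p_group_center_nontrivial:
  assumes p: "prime (p::nat)" "order G = p ^ n" "order G \<noteq> 1"
  obtains z where "z \<in> carrier G" "z \<noteq> \<one>" "\<And>g. g \<in> carrier G \<Longrightarrow> g \<otimes> z = z \<otimes> g"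
proof (rule ccontr)
  assume "\<not> thesis"
  with that have no: "\<exists>g\<in>carrier G. g \<otimes> z \<noteq> z \<otimes> g" if "z \<in> carrier G" "z \<noteq> \<one>" for z
    using that by blast
  define \<phi> where "\<phi> = (\<lambda>g. \<lambda>h\<in>carrier G. g \<otimes> h \<otimes> inv g)"
  interpret group_action G "carrier G" \<phi>
    unfolding \<phi>_def by (rule action_by_conjugation)
  have "0 < order G"
    using p by (simp add: prime_gt_0_nat)
  then have fin: "finite (carrier G)"
    using order_gt_0_iff_finite by blast
  let ?O = "orbits G (carrier G) \<phi>"
  have sub: "orb \<subseteq> carrier G" if "orb \<in> ?O" for orb
    using orbits_coverture that by blast
  then have finO: "finite ?O"
    using fin finite_subset[of ?O "Pow (carrier G)"] by blast
  have one: "orbit G \<phi> \<one> = {\<one>}"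
    by (auto simp: orbit_def \<phi>_def intro!: exI[of _ \<one>])
  have dvd: "p dvd card orb" if orb: "orb \<in> ?O - {{\<one>}}" for orb
  proof -
    obtain z where z: "z \<in> carrier G" "orb = orbit G \<phi> z"
      using orb by (auto simp: orbits_def)
    then have "z \<noteq> \<one>"
      using one orb by auto
    then obtain g where g: "g \<in> carrier G" "g \<otimes> z \<noteq> z \<otimes> g"
      using no z by blast
    then have "\<phi> g z \<noteq> z"
      using z inv_solve_right[of z "g \<otimes> z" g] by (auto simp: \<phi>_def)
    moreover have "{z, \<phi> g z} \<subseteq> orb"
      using z g orbit_refl[of z] by (auto simp: orbit_def)
    ultimately have "card orb \<noteq> 1"
      by (auto simp: card_1_singleton_iff)
    moreover have "card orb dvd p ^ n"
      using orbit_stabilizer_theorem[OF z(1)] z(2) p(2) by (metis dvd_triv_left)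
    ultimately show ?thesis
      using p(1) by (auto simp: divides_primepow_nat elim!: gr0_implies_Suc[elim_format])
  qed
  have "order G = (\<Sum>orb\<in>?O. card orb)"
    using disjoint_sum[OF fin, of "\<lambda>_. 1::nat"] by (simp add: order_def)
  also have "\<dots> = 1 + (\<Sum>orb\<in>?O - {{\<one>}}. card orb)"
    using sum.remove[OF finO, of "{\<one>}" card] one by (force simp: orbits_def)
  finally have "order G = 1 + (\<Sum>orb\<in>?O - {{\<one>}}. card orb)" .
  moreover have "p dvd (\<Sum>orb\<in>?O - {{\<one>}}. card orb)"
    using dvd by (rule dvd_sum)
  moreover have "p dvd order G"
    using p by (cases n) auto
  ultimately show False
    using p(1) by (metis dvd_add_left_iff not_prime_unit)
qed

text \<open>
  If \<open>N \<noteq> G\<close> is a solvable normal subgroup, then the preimage of the centre of \<open>G/N\<close> is a strictly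
  larger one.
\<close>

lemma (in group) p_group_derived_series_trivial:
  assumes p: "prime (p::nat)" "order G = p ^ n"
  shows "\<exists>k. (derived G ^^ k) (carrier G) = {\<one>}"
proof -
  \<comment> \<open>These are the normal subgroups with terminating derived series. They are finite
    in number and include the trivial one, so a maximal member exists.\<close>
  define \<N> where "\<N> = {N. N \<lhd> G \<and> (\<exists>k. (derived G ^^ k) N \<subseteq> {\<one>})}"
  have "0 < order G"
    using p by (simp add: prime_gt_0_nat)
  then have fin: "finite (carrier G)"
    using order_gt_0_iff_finite by blast
  have "finite \<N>"
    by (rule finite_subset[of _ "Pow (carrier G)"])
      (auto simp: \<N>_def fin dest: normal_imp_subgroup subgroup.mem_carrier)
  moreover have "{\<one>} \<in> \<N>"
    unfolding \<N>_def using one_is_normal by (auto intro!: exI[of _ 0])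
  ultimately obtain N where N: "N \<in> \<N>" and max: "\<And>M. \<lbrakk>M \<in> \<N>; N \<subseteq> M\<rbrakk> \<Longrightarrow> N = M"
    using finite_has_maximal[of \<N>] by blast
  interpret N: normal N G
    using N by (simp add: \<N>_def)
  interpret h: group_hom G "G Mod N" "\<lambda>x. N #> x"
    using N.r_coset_hom_Mod N.factorgroup_is_group
    by (simp add: group_hom_def group_hom_axioms_def)
  have one: "N #> x = \<one>\<^bsub>G Mod N\<^esub> \<longleftrightarrow> x \<in> N" if "x \<in> carrier G" for x
    using that coset_join1 coset_join2 N.subgroup_axioms by (metis one_FactGroup)
  have surj: "carrier (G Mod N) = (\<lambda>x. N #> x) ` carrier G"
    by (auto simp: FactGroup_def RCOSETS_def)
  have "N = carrier G"
  proof (rule ccontr)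
    assume "N \<noteq> carrier G"
    then obtain y where y: "y \<in> carrier G" "y \<notin> N"
      using N.subset by blast
    have "order (G Mod N) dvd p ^ n"
      using lagrange[OF N.subgroup_axioms] p by (simp add: order_def FactGroup_def) (metis dvd_triv_left order_def)
    then obtain j where j: "order (G Mod N) = p ^ j"
      using p divides_primepow_nat by blast
    have "order (G Mod N) \<noteq> 1"
    proof
      assume "order (G Mod N) = 1"
      then have "N #> y = \<one>\<^bsub>G Mod N\<^esub>"
        using h.H.one_closed h.hom_closed[OF y(1)] by (metis card_1_singletonE order_def singletonD)
      then show False
        using one y by blast
    qed
    then obtain z where z: "z \<in> carrier (G Mod N)" "z \<noteq> \<one>\<^bsub>G Mod N\<^esub>"
      "\<And>g. g \<in> carrier (G Mod N) \<Longrightarrow> g \<otimes>\<^bsub>G Mod N\<^esub> z = z \<otimes>\<^bsub>G Mod N\<^esub> g"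
      using h.H.p_group_center_nontrivial[OF p(1) j] by blast
    define Z where "Z = {z \<in> carrier (G Mod N). \<forall>q\<in>carrier (G Mod N). q \<otimes>\<^bsub>G Mod N\<^esub> z = z \<otimes>\<^bsub>G Mod N\<^esub> q}"
    have Z: "subgroup Z (G Mod N)"
      unfolding Z_def by (rule h.H.subgroup_center)
    define M where "M = {x \<in> carrier G. N #> x \<in> Z}"
    \<comment> \<open>A central coset is fixed by conjugation; this yields both the normality of
      \<open>M\<close> and that its commutators lie in \<open>N\<close>.\<close>
    have conj: "N #> (g \<otimes> x \<otimes> inv g) = N #> x" if "x \<in> M" "g \<in> carrier G" for x g
      using that by (simp add: M_def Z_def h.H.m_assoc del: mult_FactGroup one_FactGroup)
    have "subgroup M G"
      using subgroup.m_closed[OF Z] subgroup.m_inv_closed[OF Z] subgroup.one_closed[OF Z]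
      unfolding M_def by unfold_locales (simp_all del: mult_FactGroup one_FactGroup)
    then have "M \<lhd> G"
      unfolding normal_inv_iff using conj by (auto simp: M_def)
    have "derived G M \<subseteq> N"
      unfolding derived_def
    proof (rule generate_subgroup_incl[OF _ N.subgroup_axioms], clarsimp)
      fix a b assume ab: "a \<in> M" "b \<in> M"
      then have ab': "a \<in> carrier G" "b \<in> carrier G"
        by (auto simp: M_def)
      then have "N #> (a \<otimes> b \<otimes> inv a \<otimes> inv b) = \<one>\<^bsub>G Mod N\<^esub>"
        using conj[OF ab(2) ab'(1)] by (simp del: mult_FactGroup one_FactGroup)
      then show "a \<otimes> b \<otimes> inv a \<otimes> inv b \<in> N"
        by (rule iffD1[OF one, rotated]) (use ab' in simp)
    qed
    then have "(derived G ^^ k) (derived G M) \<subseteq> (derived G ^^ k) N" for k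
      by (rule mono_exp_of_derived)
    then have "(derived G ^^ Suc k) M \<subseteq> (derived G ^^ k) N" for k
      by (simp add: funpow_swap1)
    moreover obtain k where "(derived G ^^ k) N \<subseteq> {\<one>}"
      using N by (auto simp: \<N>_def)
    ultimately have "(derived G ^^ Suc k) M \<subseteq> {\<one>}"
      by (rule subset_trans)
    with \<open>M \<lhd> G\<close> have "M \<in> \<N>"
      unfolding \<N>_def by (intro CollectI conjI exI[of _ "Suc k"])
    moreover have "N \<subseteq> M"
    proof
      fix x assume "x \<in> N"
      then have "x \<in> carrier G" "N #> x = \<one>\<^bsub>G Mod N\<^esub>"
        using one N.subset by blast+
      then show "x \<in> M"
        using subgroup.one_closed[OF Z] by (simp add: M_def del: one_FactGroup)
    qed
    ultimately have "N = M"
      by (rule max)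
    obtain x where x: "x \<in> carrier G" "z = N #> x"
      using z(1) unfolding surj by (elim imageE)
    then have "x \<in> M"
      using z by (simp add: M_def Z_def)
    then show False
      using \<open>N = M\<close> one[OF x(1)] x(2) z(2) by simp
  qed
  then obtain k where "(derived G ^^ k) (carrier G) \<subseteq> {\<one>}"
    using N by (auto simp: \<N>_def)
  moreover have "\<one> \<in> (derived G ^^ k) (carrier G)"
    using exp_of_derived_is_subgroup[OF subgroup_self] subgroup.one_closed by blast
  ultimately show ?thesis
    by blast
qed

section \<open>Exponents\<close>

text \<open>The remainder of \<open>m\<close> modulo the least positive annihilating exponent also
  annihilates the group, so it is 0.\<close>

lemma group_exponent_dvd:
  assumes "group G" "\<And>x. x \<in> carrier G \<Longrightarrow> x [^]\<^bsub>G\<^esub> (m::nat) = \<one>\<^bsub>G\<^esub>"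
  shows "group_exponent G dvd m"
proof (cases "m = 0")
  case False
  interpret group G by fact
  let ?P = "\<lambda>n. n > 0 \<and> (\<forall>x\<in>carrier G. x [^]\<^bsub>G\<^esub> (n::nat) = \<one>\<^bsub>G\<^esub>)"
  have m: "?P m"
    using False assms(2) by blast
  then have eq: "group_exponent G = Least ?P"
    unfolding group_exponent_def by (intro if_P exI)
  define e where "e = Least ?P"
  have e: "?P e"
    unfolding e_def using m by (rule LeastI)
  have "x [^]\<^bsub>G\<^esub> (m mod e) = \<one>\<^bsub>G\<^esub>" if x: "x \<in> carrier G" for x
  proof -
    have "x [^]\<^bsub>G\<^esub> m = (x [^]\<^bsub>G\<^esub> e) [^]\<^bsub>G\<^esub> (m div e) \<otimes>\<^bsub>G\<^esub> x [^]\<^bsub>G\<^esub> (m mod e)"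
      using x by (simp add: nat_pow_pow nat_pow_mult)
    then show ?thesis
      using m e x by simp
  qed
  moreover have "m mod e < e"
    using e by simp
  ultimately have "m mod e = 0"
    using not_less_Least[of "m mod e" ?P] by (auto simp: e_def)
  then show ?thesis
    unfolding eq e_def by (rule dvd_eq_mod_eq_0[THEN iffD2])
qed simp

lemma (in group) group_exponent_finite:
  assumes "finite (carrier G)"
  shows "0 < group_exponent G" "x \<in> carrier G \<Longrightarrow> x [^] group_exponent G = \<one>"
    "group_exponent G dvd order G"
proof -
  let ?P = "\<lambda>n. n > 0 \<and> (\<forall>x\<in>carrier G. x [^] (n::nat) = \<one>)"
  have ex: "?P (order G)"
    using assms order_gt_0_iff_finite pow_order_eq_1 by blast
  then have "group_exponent G = Least ?P"
    unfolding group_exponent_def by (intro if_P exI)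
  then have "?P (group_exponent G)"
    using LeastI[of ?P, OF ex] by simp
  then show "0 < group_exponent G" "x \<in> carrier G \<Longrightarrow> x [^] group_exponent G = \<one>"
    by auto
  show "group_exponent G dvd order G"
    by (rule group_exponent_dvd) (use ex is_group in auto)
qed

lemma group_exponent_H2_dvd:
  assumes G: "group G" and A: "comm_group A"
    and pow: "\<And>f. f \<in> cocycles2 G A \<Longrightarrow> f [^]\<^bsub>cochains2 G A\<^esub> (m::nat) \<in> coboundaries2 G A"
  shows "group_exponent (H2 G A) dvd m"
proof (rule group_exponent_dvd)
  define Z where "Z = (cochains2 G A)\<lparr>carrier := cocycles2 G A\<rparr>"
  interpret B: normal "coboundaries2 G A" Z
    unfolding Z_def by (rule normal_coboundaries2[OF G A])
  show "group (H2 G A)"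
    unfolding H2_def Z_def[symmetric] by (rule B.factorgroup_is_group)
  fix x assume "x \<in> carrier (H2 G A)"
  then obtain f where f: "f \<in> carrier Z" "x = coboundaries2 G A #>\<^bsub>Z\<^esub> f"
    unfolding H2_def Z_def[symmetric] by (auto simp: FactGroup_def RCOSETS_def)
  have Z_pow: "f [^]\<^bsub>Z\<^esub> k = f [^]\<^bsub>cochains2 G A\<^esub> k" for k :: nat
    unfolding Z_def by (simp add: nat_pow_def)
  have "f [^]\<^bsub>Z\<^esub> m \<in> coboundaries2 G A"
    unfolding Z_pow using f by (intro pow) (simp add: Z_def)
  then have "x [^]\<^bsub>Z Mod coboundaries2 G A\<^esub> m = coboundaries2 G A"
    using f B.FactGroup_pow[OF f(1), of m] B.coset_join2[of "f [^]\<^bsub>Z\<^esub> m"] B.subgroup_axioms by simp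
  then show "x [^]\<^bsub>H2 G A\<^esub> m = \<one>\<^bsub>H2 G A\<^esub>"
    unfolding H2_def Z_def[symmetric] by simp
qed

text \<open>Leaving \<open>m\<close> free lets one statement serve both \<open>m = e\<close> for odd
  exponent \<open>e\<close> and \<open>m = 2 * e\<close> in general.\<close>

theorem group_exponent_H2_dvd_power:
  assumes "group G" "comm_group A"
    and div: "\<And>a k. \<lbrakk>a \<in> carrier A; 0 < (k::nat)\<rbrakk> \<Longrightarrow> \<exists>c\<in>carrier A. c [^]\<^bsub>A\<^esub> k = a"
    and fin: "finite (carrier G)"
    and m: "group_exponent G dvd m" "group_exponent G dvd (m choose 2)"
    and d: "(derived G ^^ Suc d) (carrier G) = {\<one>\<^bsub>G\<^esub>}"
  shows "group_exponent (H2 G A) dvd m ^ d * group_exponent G"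
proof (rule group_exponent_H2_dvd[OF assms(1,2)])
  interpret group G by fact
  fix f assume "f \<in> cocycles2 G A"
  with assms(1,2) interpret cocycle G A f
    by (simp add: cocycle_def cocycle_axioms_def)
  show "f [^]\<^bsub>cochains2 G A\<^esub> (m ^ d * group_exponent G) \<in> coboundaries2 G A"
    by (rule pow_in_coboundaries2[OF div fin _ _ m d]) (use group_exponent_finite[OF fin] in auto)
qed

section \<open>Specialisation to complex coefficients and finite p-groups\<close>

lemma nonzero_complex_divisible:
  assumes "a \<in> carrier nonzero_complex" "0 < (k::nat)"
  shows "\<exists>c\<in>carrier nonzero_complex. c [^]\<^bsub>nonzero_complex\<^esub> k = a"
proof -
  have "c [^]\<^bsub>nonzero_complex\<^esub> j = c ^ j" for c and j :: nat
    by (induction j) (auto simp: nonzero_complex_def)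
  moreover have "rcis (root k (cmod a)) (Arg a / k) ^ k = a"
    using assms by (simp add: DeMoivre2 rcis_cmod_Arg)
  ultimately show ?thesis
    using assms by (intro bexI[of _ "rcis (root k (cmod a)) (Arg a / k)"]) (auto simp: nonzero_complex_def)
qed

theorem theorem1:
  fixes G :: "('a, 'b) monoid_scheme" and p n d :: nat
  assumes "prime p"
    and "group G"
    and "finite (carrier G)"
    and "order G = p ^ n"
    and "derived_length G = d"
    and "d \<ge> 1"
  shows "(p = 2 \<longrightarrow>
            group_exponent (schur_multiplier G) dvd 2 ^ (d - 1) * group_exponent G ^ d) \<and>
         (p > 2 \<longrightarrow>
            group_exponent (schur_multiplier G) dvd group_exponent G ^ d)"
proof -
  interpret group G by fact
  obtain c where c: "d = Suc c"
    using assms(6) by (cases d) auto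
  \<comment> \<open>The minimum defining \<open>derived_length\<close> is attained because finite
    p-groups are solvable.\<close>
  have "(derived G ^^ derived_length G) (carrier G) = {\<one>\<^bsub>G\<^esub>}"
    unfolding derived_length_def
    by (rule LeastI_ex[OF p_group_derived_series_trivial[OF assms(1,4)]])
  then have derived: "(derived G ^^ Suc c) (carrier G) = {\<one>\<^bsub>G\<^esub>}"
    by (simp only: assms(5) c)
  let ?e = "group_exponent G"
  have bound: "group_exponent (schur_multiplier G) dvd m ^ c * ?e"
    if "?e dvd m" "?e dvd (m choose 2)" for m
    unfolding schur_multiplier_def
    by (rule group_exponent_H2_dvd_power[OF assms(2) comm_group_nonzero_complex
          nonzero_complex_divisible assms(3) that derived])
  \<comment> \<open>The binomial equals \<open>?e * (2 * ?e - 1)\<close>: doubling absorbs the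
    denominator.\<close>
  have "?e dvd (2 * ?e choose 2)"
    by (simp add: choose_two mult.assoc)
  then have "group_exponent (schur_multiplier G) dvd (2 * ?e) ^ c * ?e"
    by (intro bound) auto
  moreover have "group_exponent (schur_multiplier G) dvd ?e ^ c * ?e" if "p > 2"
  proof (intro bound)
    \<comment> \<open>An odd exponent makes \<open>(?e - 1) div 2\<close> an exact half, so
      \<open>?e\<close> divides \<open>?e choose 2\<close> without doubling.\<close>
    have "odd (p ^ n)"
      using assms(1) that by (simp add: prime_odd_nat)
    then have "odd ?e"
      using group_exponent_finite(3)[OF assms(3)] assms(4) by (metis dvd_trans)
    then obtain b where "?e = 2 * b + 1"
      by (elim oddE)
    then have "(?e choose 2) = ?e * b"
      by (simp add: choose_two algebra_simps)
    then show "?e dvd (?e choose 2)"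
      by simp
  qed simp
  ultimately show ?thesis
    by (simp add: c power_mult_distrib mult.assoc mult.commute mult.left_commute)
qed

end
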